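(* Let $d \geq 2$, $s \in (0,1)$, $p \in (1,\infty)$ with $sp \neq 1$. Let $\Omega \subset \mathbb{R}^d$ be a bounded domain with $C^1$ boundary $\partial\Omega$. Then there exists a constant $C = C(d,s,p,\Omega)$ such that for every $\mathbf{u} \in [C^1_c(\Omega)]^d$, $$|\mathbf{u}|_{W^{s,p}(\Omega)} \leq C\left( [\mathbf{u}]_{\mathcal{X}^{s,p}(\Omega)} + \|\mathbf{u}\|_{L^p(\Omega)} \right).$$ By density, the inequality holds for all $\mathbf{u} \in [W^{s,p}_0(\Omega)]^d$.
   Context: For an open set $\Omega\subset\mathbb{R}^d$ and a vector field $\mathbf{u}:\Omega\to\mathbb{R}^d$, define $$[\mathbf{u}]_{\mathcal{X}^{s,p}(\Omega)}^p := \int_\Omega\int_\Omega \frac{\left| (\mathbf{u}(\mathbf{x})-\mathbf{u}(\mathbf{y}))\cdot\frac{\mathbf{x}-\mathbf{y}}{|\mathbf{x}-\mathbf{y}|}\right|^p}{|\mathbf{x}-\mathbf{y}|^{d+sp}}\,d\mathbf{y}\,d\mathbf{x}, \qquad |\mathbf{u}|_{W^{s,p}(\Omega)}^p := \int_\Omega\int_\Omega \frac{|\mathbf{u}(\mathbf{x})-\mathbf{u}(\mathbf{y})|^p}{|\mathbf{x}-\mathbf{y}|^{d+sp}}\,d\mathbf{y}\,d\mathbf{x}.$$ $[C^1_c(\Omega)]^d$ denotes the set of continuously differentiable vector fields $\mathbf{u}:\Omega\to\mathbb{R}^d$ whose support is compactly contained in $\Omega$. $[W^{s,p}_0(\Omega)]^d$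 is the closure of $[C^1_c(\Omega)]^d$ with respect to the norm $\|\mathbf{u}\|_{W^{s,p}} = |\mathbf{u}|_{W^{s,p}(\Omega)} + \|\mathbf{u}\|_{L^p(\Omega)}$. *)

theory Defs
  imports "HOL-Analysis.Analysis"
begin

definition continuously_differentiable_on ::
  "'a::euclidean_space set \<Rightarrow> ('a \<Rightarrow> 'b::real_normed_vector) \<Rightarrow> bool" where
  "continuously_differentiable_on S f \<longleftrightarrow>
     (\<exists>f'. (\<forall>x\<in>S. (f has_derivative blinfun_apply (f' x)) (at x)) \<and> continuous_on S f')"

text \<open>
  Near every boundary point, \<Omega> is the part of a ball lying strictly above the graph of a
  \<open>C\<^sup>1\<close> function over the hyperplane orthogonal to a unit vector \<open>\<nu>\<close>. The function \<open>\<gamma>\<close> is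
  declared on the whole space but only its values on that hyperplane matter: a \<open>C\<^sup>1\<close> function
  on the hyperplane extends to the whole space by composing with the orthogonal projection.
\<close>

definition C1_boundary :: "'a::euclidean_space set \<Rightarrow> bool" where
  "C1_boundary \<Omega> \<longleftrightarrow>
     (\<forall>z\<in>frontier \<Omega>. \<exists>r>0. \<exists>\<nu>. \<exists>\<gamma> :: 'a \<Rightarrow> real.
        norm \<nu> = 1 \<and> continuously_differentiable_on UNIV \<gamma> \<and>
        \<Omega> \<inter> ball z r = {x \<in> ball z r. \<gamma> (x - (x \<bullet> \<nu>) *\<^sub>R \<nu>) < x \<bullet> \<nu>})"

text \<open>
  The seminorms and norms below take values in \<open>[0,\<infinity>]\<close>; hence the \<open>p\<close>-th root has to be
  extended to \<open>\<infinity>\<close>. Fields on \<open>\<Omega>\<close> are total functions, of which only the values on \<open>\<Omega>\<close> are used.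
\<close>

definition ennreal_root :: "real \<Rightarrow> ennreal \<Rightarrow> ennreal" where
  "ennreal_root p t = (if t = \<infinity> then \<infinity> else ennreal (enn2real t powr (1 / p)))"

definition X_seminorm ::
  "real \<Rightarrow> real \<Rightarrow> 'a::euclidean_space set \<Rightarrow> ('a \<Rightarrow> 'a) \<Rightarrow> ennreal" where
  "X_seminorm s p \<Omega> u = ennreal_root p
     (\<integral>\<^sup>+x. (\<integral>\<^sup>+y. ennreal
        (\<bar>(u x - u y) \<bullet> ((x - y) /\<^sub>R norm (x - y))\<bar> powr p
          / norm (x - y) powr (real DIM('a) + s * p))
      \<partial>lebesgue_on \<Omega>) \<partial>lebesgue_on \<Omega>)"

definition W_seminorm ::
  "real \<Rightarrow> real \<Rightarrow> 'a::euclidean_space set \<Rightarrow> ('a \<Rightarrow> 'a) \<Rightarrow> ennreal" where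
  "W_seminorm s p \<Omega> u = ennreal_root p
     (\<integral>\<^sup>+x. (\<integral>\<^sup>+y. ennreal
        (norm (u x - u y) powr p / norm (x - y) powr (real DIM('a) + s * p))
      \<partial>lebesgue_on \<Omega>) \<partial>lebesgue_on \<Omega>)"

definition Lp_norm :: "real \<Rightarrow> 'a::euclidean_space set \<Rightarrow> ('a \<Rightarrow> 'a) \<Rightarrow> ennreal" where
  "Lp_norm p \<Omega> u = ennreal_root p (\<integral>\<^sup>+x. ennreal (norm (u x) powr p) \<partial>lebesgue_on \<Omega>)"

definition W_norm ::
  "real \<Rightarrow> real \<Rightarrow> 'a::euclidean_space set \<Rightarrow> ('a \<Rightarrow> 'a) \<Rightarrow> ennreal" where
  "W_norm s p \<Omega> u = W_seminorm s p \<Omega> u + Lp_norm p \<Omega> u"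

definition C1c :: "'a::euclidean_space set \<Rightarrow> ('a \<Rightarrow> 'a) set" where
  "C1c \<Omega> = {u. continuously_differentiable_on \<Omega> u \<and>
     compact (closure {x\<in>\<Omega>. u x \<noteq> 0}) \<and> closure {x\<in>\<Omega>. u x \<noteq> 0} \<subseteq> \<Omega>}"

text \<open>
  Elements are represented by Lebesgue measurable functions rather than by classes modulo
  equality almost everywhere; every representative of a class is included.
\<close>

definition W0 :: "real \<Rightarrow> real \<Rightarrow> 'a::euclidean_space set \<Rightarrow> ('a \<Rightarrow> 'a) set" where
  "W0 s p \<Omega> = {u \<in> borel_measurable (lebesgue_on \<Omega>).
     W_norm s p \<Omega> u < \<infinity> \<and>
     (\<forall>\<epsilon>::real. \<epsilon> > 0 \<longrightarrow> (\<exists>v\<in>C1c \<Omega>. W_norm s p \<Omega> (\<lambda>x. u x - v x) < ennreal \<epsilon>))}"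

end

theory Submission
  imports Defs
begin

text \<open>
  Write \<open>D x z = (u x - u z) \<bullet> (x - z)\<close>. Everything rests on the identity
  \<open>(u x - u y) \<bullet> (x - z) = D x z - D y z - (u y - u z) \<bullet> (x - y)\<close>.
  Take \<open>z\<close> at distance comparable to \<open>M * norm (x - y)\<close> from \<open>x\<close>. Since \<open>\<Omega>\<close> contains
  a ball of radius proportional to every small scale near each of its points, \<open>z\<close> can range
  over a ball in \<open>\<Omega>\<close> on which \<open>x - z\<close> has a component of size comparable to
  \<open>M * norm (x - y)\<close> along \<open>u x - u y\<close>. Hence \<open>norm (u x - u y)\<close> is at most a constant times
  \<open>norm (u y - u z) / M\<close> plus the strains of the pairs \<open>(x, z)\<close> and \<open>(y, z)\<close>. Take \<open>p\<close>-th
  powers, average over \<open>z\<close> and integrate: by Tonelli, the first term contributes a constant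
  times \<open>M powr (s * p - p)\<close> times the double integral of the left-hand side itself, which is
  absorbed for large \<open>M\<close> because \<open>s < 1\<close>. To have a finite quantity to absorb, only pairs
  with \<open>norm (x - y) > \<epsilon>\<close> are integrated, and \<open>\<epsilon>\<close> tends to 0 at the end; pairs at large
  distance are controlled by the \<open>L\<^sup>p\<close> norm.
\<close>

section \<open>Interior balls and the pointwise estimate by strains\<close>

text \<open>The interior corkscrew condition at all scales up to \<open>R\<close>. The points
  \<open>x\<close> range over a separate set \<open>U\<close>, so that the condition can be proved
  locally and patched together by compactness.\<close>

definition corkscrew :: "'a::metric_space set \<Rightarrow> 'a set \<Rightarrow> real \<Rightarrow> real \<Rightarrow> bool" where
  "corkscrew U \<Omega> c R \<longleftrightarrow>
    (\<forall>x\<in>U. \<forall>\<rho>. 0 < \<rho> \<and> \<rho> \<le> R \<longrightarrow> (\<exists>\<zeta>. ball \<zeta> (c * \<rho>) \<subseteq> \<Omega> \<inter> ball x \<rho>))"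

definition strain :: "('a::real_inner \<Rightarrow> 'a) \<Rightarrow> 'a \<Rightarrow> 'a \<Rightarrow> real" where
  "strain u x y = \<bar>(u x - u y) \<bullet> ((x - y) /\<^sub>R norm (x - y))\<bar>"

lemma abs_inner_eq_strain: "\<bar>(u x - u y) \<bullet> (x - y)\<bar> = strain u x y * norm (x - y)"
  by (cases "x = y") (auto simp: strain_def abs_mult)

text \<open>Let \<open>e\<close> be the direction of \<open>u x - u y\<close> and
  \<open>\<rho> = M * norm (x - y)\<close>. Shift the centre of the given ball by half its radius
  along \<open>e\<close> or \<open>- e\<close>, away from the hyperplane through \<open>x\<close>
  orthogonal to \<open>e\<close>, and keep a quarter of the radius: there \<open>x - z\<close> has a
  component of size at least \<open>c * \<rho> / 4\<close> along \<open>e\<close>, by which the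
  three-point identity is divided. The bound \<open>8 / c \<le> M\<close> puts \<open>y\<close>
  within \<open>c * \<rho> / 8\<close> of \<open>x\<close>, so \<open>z\<close> keeps its distance
  from \<open>y\<close> too.\<close>

lemma difference_le_strain:
  fixes u :: "'a::euclidean_space \<Rightarrow> 'a"
  assumes c: "0 < c" and M: "8 / c \<le> M" "1 \<le> M" and xy: "x \<noteq> y"
    and ball: "ball \<zeta> (c * (M * norm (x - y))) \<subseteq> \<Omega> \<inter> ball x (M * norm (x - y))"
  obtains \<zeta>' where
    "\<And>z. z \<in> ball \<zeta>' (c * (M * norm (x - y)) / 4) \<Longrightarrow> z \<in> \<Omega> \<and>
       c * (M * norm (x - y)) / 8 \<le> norm (x - z) \<and> norm (x - z) \<le> 2 * (M * norm (x - y)) \<and>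
       c * (M * norm (x - y)) / 8 \<le> norm (y - z) \<and> norm (y - z) \<le> 2 * (M * norm (x - y)) \<and>
       norm (u x - u y) \<le> 8 / c * (norm (u y - u z) / M + strain u x z + strain u y z)"
proof -
  define r where "r = norm (x - y)"
  define \<rho> where "\<rho> = M * r"
  have r0: "0 < r" using xy by (simp add: r_def)
  have M0: "0 < M" using M by simp
  have \<rho>0: "0 < \<rho>" using r0 M0 by (simp add: \<rho>_def)
  have r\<rho>: "r \<le> c * \<rho> / 8" using M(1) c r0 by (simp add: \<rho>_def field_simps)
  have r\<rho>': "r \<le> \<rho>" using M(2) r0 by (simp add: \<rho>_def)
  \<comment> \<open>If \<open>u x = u y\<close>, any unit vector serves.\<close>
  obtain e :: 'a where e: "norm e = 1" and ve: "u x - u y = norm (u x - u y) *\<^sub>R e"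
  proof (cases "u x - u y = 0")
    case True
    then show ?thesis using that vector_choose_size[of 1] by auto
  next
    case False
    then show ?thesis using that[of "(u x - u y) /\<^sub>R norm (u x - u y)"] by auto
  qed
  \<comment> \<open>The sign selects the side of the hyperplane on which \<open>\<zeta>\<close>
    lies, so that the shift and \<open>\<zeta> - x\<close> add up along \<open>e\<close> instead of
    cancelling.\<close>
  define \<sigma> :: real where "\<sigma> = (if 0 \<le> e \<bullet> (\<zeta> - x) then 1 else -1)"
  have \<sigma>: "\<bar>\<sigma>\<bar> = 1" "\<sigma> * \<sigma> = 1" by (auto simp: \<sigma>_def)
  define \<zeta>' where "\<zeta>' = \<zeta> + (\<sigma> * (c * \<rho> / 2)) *\<^sub>R e"
  have c\<rho>: "0 < c * \<rho>" using c \<rho>0 by simp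
  show ?thesis
  proof (rule that[of \<zeta>'], fold r_def, fold \<rho>_def)
    fix z assume "z \<in> ball \<zeta>' (c * \<rho> / 4)"
    then have z: "norm (z - \<zeta>') < c * \<rho> / 4" by (simp add: dist_norm norm_minus_commute)
    \<comment> \<open>The shift \<open>c * \<rho> / 2\<close> plus the new radius
      \<open>c * \<rho> / 4\<close> stays below \<open>c * \<rho>\<close>.\<close>
    have "norm (\<zeta>' - \<zeta>) = c * \<rho> / 2" using c \<rho>0 e \<sigma> by (simp add: \<zeta>'_def abs_mult)
    then have "norm (z - \<zeta>) < c * \<rho>"
      using z c\<rho> norm_triangle_ineq[of "z - \<zeta>'" "\<zeta>' - \<zeta>"] by simp
    then have "z \<in> ball \<zeta> (c * \<rho>)" by (simp add: dist_norm norm_minus_commute)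
    then have z\<Omega>: "z \<in> \<Omega>" and zx: "norm (x - z) < \<rho>"
      using ball by (auto simp: r_def \<rho>_def dist_norm)
    have "\<bar>e \<bullet> (z - \<zeta>')\<bar> \<le> norm (z - \<zeta>')" using Cauchy_Schwarz_ineq2[of e "z - \<zeta>'"] e by simp
    then have 1: "- (c * \<rho> / 4) \<le> \<sigma> * (e \<bullet> (z - \<zeta>'))" using z \<sigma>(1) by (auto simp: \<sigma>_def)
    have "\<sigma> * (e \<bullet> (z - x)) =
        \<sigma> * (e \<bullet> (z - \<zeta>')) + \<sigma> * (e \<bullet> (\<zeta> - x)) + \<sigma> * \<sigma> * (c * \<rho> / 2) * (e \<bullet> e)"
      by (simp add: \<zeta>'_def inner_diff_right inner_add_right algebra_simps)
    moreover have "e \<bullet> e = 1" using e by (simp add: dot_square_norm)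
    ultimately have 2: "\<sigma> * (e \<bullet> (z - x)) = \<sigma> * (e \<bullet> (z - \<zeta>')) + \<sigma> * (e \<bullet> (\<zeta> - x)) + c * \<rho> / 2"
      using \<sigma>(2) by simp
    have "0 \<le> \<sigma> * (e \<bullet> (\<zeta> - x))" by (simp add: \<sigma>_def)
    with 1 2 have "c * \<rho> / 4 \<le> \<sigma> * (e \<bullet> (z - x))" by linarith
    moreover have "\<bar>\<sigma> * (e \<bullet> (z - x))\<bar> = \<bar>e \<bullet> (x - z)\<bar>"
      unfolding abs_mult \<sigma>(1) by (simp add: inner_diff_right abs_minus_commute)
    ultimately have low: "c * \<rho> / 4 \<le> \<bar>e \<bullet> (x - z)\<bar>" by linarith
    have lowx: "c * \<rho> / 4 \<le> norm (x - z)"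
      using low Cauchy_Schwarz_ineq2[of e "x - z"] e by simp
    have tri: "norm (x - z) \<le> norm (y - z) + r" "norm (y - z) \<le> norm (x - z) + r"
      using norm_triangle_ineq[of "x - y" "y - z"] norm_triangle_ineq[of "y - x" "x - z"]
      by (auto simp: r_def norm_minus_commute)
    have upy: "norm (y - z) \<le> 2 * \<rho>" using tri zx r\<rho>' by simp
    have "(u x - u y) \<bullet> (x - z) =
        (u x - u z) \<bullet> (x - z) - (u y - u z) \<bullet> (y - z) - (u y - u z) \<bullet> (x - y)"
      by (simp add: inner_diff_left inner_diff_right)
    then have "\<bar>(u x - u y) \<bullet> (x - z)\<bar> \<le>
        \<bar>(u x - u z) \<bullet> (x - z)\<bar> + \<bar>(u y - u z) \<bullet> (y - z)\<bar> + \<bar>(u y - u z) \<bullet> (x - y)\<bar>" by linarith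
    also have "\<bar>(u y - u z) \<bullet> (x - y)\<bar> \<le> norm (u y - u z) * r"
      unfolding r_def by (rule Cauchy_Schwarz_ineq2)
    also have "\<bar>(u x - u z) \<bullet> (x - z)\<bar> \<le> strain u x z * (2 * \<rho>)"
      unfolding abs_inner_eq_strain using zx \<rho>0 by (intro mult_left_mono) (auto simp: strain_def)
    also have "\<bar>(u y - u z) \<bullet> (y - z)\<bar> \<le> strain u y z * (2 * \<rho>)"
      unfolding abs_inner_eq_strain using upy by (intro mult_left_mono) (auto simp: strain_def)
    finally have "\<bar>(u x - u y) \<bullet> (x - z)\<bar> \<le>
       strain u x z * (2 * \<rho>) + strain u y z * (2 * \<rho>) + norm (u y - u z) * r" by simp
    moreover have "\<bar>(u x - u y) \<bullet> (x - z)\<bar> = norm (u x - u y) * \<bar>e \<bullet> (x - z)\<bar>"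
      by (subst ve) (simp add: abs_mult)
    moreover have "norm (u x - u y) * (c * \<rho> / 4) \<le> norm (u x - u y) * \<bar>e \<bullet> (x - z)\<bar>"
      using low by (intro mult_left_mono) auto
    \<comment> \<open>As \<open>r = \<rho> / M\<close>, doubling this term lets all three terms
      share the factor \<open>2 * \<rho>\<close>.\<close>
    moreover have "norm (u y - u z) * r \<le> 2 * (norm (u y - u z) * r)" using r0 by simp
    ultimately have "norm (u x - u y) * (c * \<rho> / 4) \<le>
       2 * \<rho> * (norm (u y - u z) / M + strain u x z + strain u y z)"
      using M0 by (simp add: \<rho>_def algebra_simps)
    then have "norm (u x - u y) \<le> 2 * \<rho> * (norm (u y - u z) / M + strain u x z + strain u y z) / (c * \<rho> / 4)"
      using c\<rho> by (subst pos_le_divide_eq) auto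
    also have "\<dots> = 8 / c * (norm (u y - u z) / M + strain u x z + strain u y z)"
      using c \<rho>0 by (simp add: field_simps)
    finally show "z \<in> \<Omega> \<and> c * \<rho> / 8 \<le> norm (x - z) \<and> norm (x - z) \<le> 2 * \<rho> \<and>
       c * \<rho> / 8 \<le> norm (y - z) \<and> norm (y - z) \<le> 2 * \<rho> \<and>
       norm (u x - u y) \<le> 8 / c * (norm (u y - u z) / M + strain u x z + strain u y z)"
      using z\<Omega> lowx zx upy tri r\<rho> \<rho>0 c\<rho> by auto
  qed
qed

text \<open>The sum is at most three times its largest term, and the power of that term is one of
  the summands on the right.\<close>

lemma powr_sum3_le:
  fixes a b c p :: real
  assumes "0 \<le> a" "0 \<le> b" "0 \<le> c" "0 \<le> p"
  shows "(a + b + c) powr p \<le> 3 powr p * (a powr p + b powr p + c powr p)"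
proof -
  define m where "m = max a (max b c)"
  have "(a + b + c) powr p \<le> (3 * m) powr p"
    using assms by (intro powr_mono2) (auto simp: m_def)
  also have "\<dots> = 3 powr p * m powr p" using assms by (simp add: m_def powr_mult)
  also have "m powr p \<le> a powr p + b powr p + c powr p"
    by (auto simp: m_def max_def)
  finally show ?thesis by simp
qed

section \<open>Interior balls for bounded domains with C1 boundary\<close>

lemma corkscrew_mono:
  assumes "corkscrew U \<Omega> c R" "V \<subseteq> U" "c' \<le> c" "R' \<le> R"
  shows "corkscrew V \<Omega> c' R'"
  unfolding corkscrew_def
proof (intro ballI allI impI)
  fix x \<rho> assume x: "x \<in> V" and \<rho>: "0 < \<rho> \<and> \<rho> \<le> R'"
  then obtain \<zeta> where "ball \<zeta> (c * \<rho>) \<subseteq> \<Omega> \<inter> ball x \<rho>"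
    using assms unfolding corkscrew_def by (meson order_trans subsetD)
  moreover have "ball \<zeta> (c' * \<rho>) \<subseteq> ball \<zeta> (c * \<rho>)"
    using assms \<rho> by (intro subset_ball mult_right_mono) auto
  ultimately show "\<exists>\<zeta>. ball \<zeta> (c' * \<rho>) \<subseteq> \<Omega> \<inter> ball x \<rho>" by blast
qed

text \<open>The derivative is bounded on the compact ball, and the mean value inequality applies
  because the ball is convex.\<close>

lemma continuously_differentiable_lipschitz_on_cball:
  fixes f :: "'a::euclidean_space \<Rightarrow> 'b::real_normed_vector"
  assumes "continuously_differentiable_on UNIV f"
  obtains B where "0 < B"
    "\<And>x y. x \<in> cball a R \<Longrightarrow> y \<in> cball a R \<Longrightarrow> norm (f x - f y) \<le> B * norm (x - y)"
proof -
  obtain f' where f': "\<And>x. (f has_derivative blinfun_apply (f' x)) (at x)" "continuous_on UNIV f'"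
    using assms by (auto simp: continuously_differentiable_on_def)
  have "compact (f' ` cball a R)"
    by (intro compact_continuous_image continuous_on_subset[OF f'(2)]) auto
  then obtain B where B: "0 < B" "\<And>x. x \<in> cball a R \<Longrightarrow> norm (f' x) \<le> B"
    using compact_imp_bounded bounded_pos by (metis imageI)
  have "norm (f x - f y) \<le> B * norm (x - y)" if "x \<in> cball a R" "y \<in> cball a R" for x y
  proof (rule differentiable_bound[where S = "cball a R" and f' = "\<lambda>x. blinfun_apply (f' x)"])
    show "(f has_derivative blinfun_apply (f' x)) (at x within cball a R)" for x
      using f'(1) by (rule has_derivative_at_withinI)
    show "onorm (blinfun_apply (f' x)) \<le> B" if "x \<in> cball a R" for x
      using B(2)[OF that] by (simp add: norm_blinfun.rep_eq)
  qed (use that in auto)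
  then show ?thesis using that B(1) by blast
qed

text \<open>Move from \<open>x\<close> up by \<open>\<rho> / 2\<close> along \<open>\<nu>\<close>.
  On bounded sets \<open>\<gamma>\<close> is Lipschitz, so a ball around the new point whose radius
  is a small multiple of \<open>\<rho>\<close> stays above the graph.\<close>

lemma corkscrew_near_boundary:
  fixes \<Omega> :: "'a::euclidean_space set"
  assumes \<nu>: "norm \<nu> = 1" and \<gamma>: "continuously_differentiable_on UNIV \<gamma>" and r: "0 < r"
    and \<Omega>: "\<Omega> \<inter> ball z r = {x \<in> ball z r. (\<gamma> (x - (x \<bullet> \<nu>) *\<^sub>R \<nu>) :: real) < x \<bullet> \<nu>}"
  obtains c where "0 < c" "corkscrew (\<Omega> \<inter> ball z (r / 2)) \<Omega> c (r / 2)"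
proof -
  \<comment> \<open>The orthogonal projection onto the hyperplane on which \<open>\<gamma>\<close>
    matters; it does not increase norms.\<close>
  define P where "P x = x - (x \<bullet> \<nu>) *\<^sub>R \<nu>" for x
  have P_diff: "P x - P y = P (x - y)" for x y by (simp add: P_def inner_diff_left algebra_simps)
  have nn: "\<nu> \<bullet> \<nu> = 1" using \<nu> by (simp add: dot_square_norm)
  have P_norm: "norm (P x) \<le> norm x" for x
  proof -
    have "(norm (P x))\<^sup>2 = (norm x)\<^sup>2 - (x \<bullet> \<nu>)\<^sup>2"
      by (simp only: P_def power2_norm_eq_inner)
        (simp add: inner_diff_left inner_diff_right nn power2_eq_square inner_commute)
    then have "(norm (P x))\<^sup>2 \<le> (norm x)\<^sup>2" by simp
    then show ?thesis by (rule power2_le_imp_le) simp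
  qed
  have P_\<nu>: "P (x + t *\<^sub>R \<nu>) = P x" for x t by (simp add: P_def inner_add_left nn algebra_simps)
  obtain B where B: "0 < B" "\<And>x y. x \<in> cball (P z) r \<Longrightarrow> y \<in> cball (P z) r \<Longrightarrow>
      norm (\<gamma> x - \<gamma> y) \<le> B * norm (x - y)"
    using continuously_differentiable_lipschitz_on_cball[OF \<gamma>] by blast
  have PB: "\<bar>\<gamma> (P x) - \<gamma> (P y)\<bar> \<le> B * norm (P x - P y)" if "x \<in> ball z r" "y \<in> ball z r" for x y
  proof -
    have "P w \<in> cball (P z) r" if "w \<in> ball z r" for w
      using P_norm[of "z - w"] that by (simp add: dist_norm P_diff)
    then show ?thesis using B(2) that by simp
  qed
  \<comment> \<open>Within radius \<open>c * \<rho>\<close> the height drops by less than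
    \<open>c * \<rho>\<close> and the graph rises by at most \<open>B * (c * \<rho>)\<close>; the
    two losses together equal the lift \<open>\<rho> / 2\<close>.\<close>
  define c where "c = 1 / (2 * (1 + B))"
  have c: "0 < c" "c \<le> 1 / 2" "c * (1 + B) = 1 / 2" using B(1) by (auto simp: c_def field_simps)
  have "\<exists>\<zeta>. ball \<zeta> (c * \<rho>) \<subseteq> \<Omega> \<inter> ball x \<rho>"
    if x: "x \<in> \<Omega>" "x \<in> ball z (r / 2)" and \<rho>: "0 < \<rho>" "\<rho> \<le> r / 2" for x \<rho>
  proof (intro exI subsetI)
    fix w assume "w \<in> ball (x + (\<rho> / 2) *\<^sub>R \<nu>) (c * \<rho>)"
    then have w: "norm (w - (x + (\<rho> / 2) *\<^sub>R \<nu>)) < c * \<rho>" by (simp add: dist_norm norm_minus_commute)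
    have "norm (w - x) \<le> norm (w - (x + (\<rho> / 2) *\<^sub>R \<nu>)) + norm ((\<rho> / 2) *\<^sub>R \<nu>)"
      using norm_triangle_ineq[of "w - (x + (\<rho> / 2) *\<^sub>R \<nu>)" "(\<rho> / 2) *\<^sub>R \<nu>"] by simp
    also have "\<dots> < c * \<rho> + \<rho> / 2" using w \<nu> \<rho> by simp
    also have "\<dots> \<le> \<rho>" using mult_right_mono[OF c(2), of \<rho>] \<rho> by linarith
    finally have wx: "w \<in> ball x \<rho>" by (simp add: dist_norm norm_minus_commute)
    \<comment> \<open>Halving \<open>r\<close> for both the location of \<open>x\<close> and the
      scale keeps \<open>w\<close> where the graph description of \<open>\<Omega>\<close> is
      valid.\<close>
    then have wz: "w \<in> ball z r"
      using x(2) \<rho> dist_triangle[of z w x] by simp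
    have xz: "x \<in> ball z r" using x(2) r by simp
    have "\<gamma> (P x) < x \<bullet> \<nu>" using \<Omega> x(1) xz unfolding P_def by blast
    moreover have "P w - P x = P (w - (x + (\<rho> / 2) *\<^sub>R \<nu>))" by (metis P_diff P_\<nu>)
    then have "norm (P w - P x) \<le> c * \<rho>" using P_norm[of "w - (x + (\<rho> / 2) *\<^sub>R \<nu>)"] w by simp
    then have "B * norm (P w - P x) \<le> B * (c * \<rho>)" using B(1) by (intro mult_left_mono) auto
    then have "\<gamma> (P w) \<le> \<gamma> (P x) + B * (c * \<rho>)" using PB[OF wz xz] by linarith
    moreover have "\<bar>(w - (x + (\<rho> / 2) *\<^sub>R \<nu>)) \<bullet> \<nu>\<bar> < c * \<rho>"
      using Cauchy_Schwarz_ineq2[of "w - (x + (\<rho> / 2) *\<^sub>R \<nu>)" \<nu>] w \<nu> by simp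
    then have "x \<bullet> \<nu> + \<rho> / 2 - c * \<rho> < w \<bullet> \<nu>"
      using nn by (simp add: inner_diff_left inner_add_left)
    moreover have "c * \<rho> + B * (c * \<rho>) = c * (1 + B) * \<rho>" by (simp add: algebra_simps)
    then have "c * \<rho> + B * (c * \<rho>) = \<rho> / 2" using c(3) by simp
    ultimately have "\<gamma> (P w) < w \<bullet> \<nu>" by linarith
    then show "w \<in> \<Omega> \<inter> ball x \<rho>" using \<Omega> wz wx unfolding P_def by blast
  qed
  then show ?thesis using that[OF c(1)] by (auto simp: corkscrew_def)
qed

text \<open>Every point of the compact closure has a neighbourhood with its own constants: balls
  around \<open>x\<close> itself serve near interior points, the graph description near boundary
  points. A finite subcover gives uniform constants.\<close>

lemma C1_boundary_corkscrew:
  fixes \<Omega> :: "'a::euclidean_space set"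
  assumes "open \<Omega>" "bounded \<Omega>" "C1_boundary \<Omega>"
  obtains c R where "0 < c" "0 < R" "corkscrew \<Omega> \<Omega> c R"
proof -
  \<comment> \<open>One number serves as neighbourhood radius, ball constant and maximal scale, so
    that a single choice function and a single minimum suffice.\<close>
  have "\<exists>r>0. corkscrew (\<Omega> \<inter> ball z r) \<Omega> r r" if z: "z \<in> closure \<Omega>" for z
  proof (cases "z \<in> \<Omega>")
    case True
    then obtain e where e: "0 < e" "ball z e \<subseteq> \<Omega>" using assms(1) openE by blast
    \<comment> \<open>The bound \<open>e / 2\<close> keeps \<open>ball x \<rho>\<close> inside
      \<open>ball z e\<close>; the bound 1 gives \<open>r * \<rho> \<le> \<rho>\<close>.\<close>
    define r where "r = min (e / 2) 1"
    have "corkscrew (\<Omega> \<inter> ball z r) \<Omega> r r" unfolding corkscrew_def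
    proof (intro ballI allI impI exI)
      fix x \<rho> assume x: "x \<in> \<Omega> \<inter> ball z r" and \<rho>: "0 < \<rho> \<and> \<rho> \<le> r"
      have "r \<le> 1" by (simp add: r_def)
      then have *: "r * \<rho> \<le> \<rho>" using mult_right_mono[of r 1 \<rho>] \<rho> by simp
      have "ball x \<rho> \<subseteq> ball z e"
      proof
        fix w assume "w \<in> ball x \<rho>"
        then show "w \<in> ball z e" using x \<rho> dist_triangle[of z w x] by (simp add: r_def)
      qed
      then show "ball x (r * \<rho>) \<subseteq> \<Omega> \<inter> ball x \<rho>" using e * subset_ball[OF *, of x] by blast
    qed
    moreover have "0 < r" using e by (simp add: r_def)
    ultimately show ?thesis by blast
  next
    case False
    then have "z \<in> frontier \<Omega>" using z assms(1) by (simp add: frontier_def interior_open)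
    then obtain r \<nu> and \<gamma> :: "'a \<Rightarrow> real" where r: "r > 0" and *: "norm \<nu> = 1"
      "continuously_differentiable_on UNIV \<gamma>"
      "\<Omega> \<inter> ball z r = {x \<in> ball z r. \<gamma> (x - (x \<bullet> \<nu>) *\<^sub>R \<nu>) < x \<bullet> \<nu>}"
      using assms(3) unfolding C1_boundary_def by blast
    from corkscrew_near_boundary[OF *(1,2) r *(3)]
    obtain c where c: "0 < c" "corkscrew (\<Omega> \<inter> ball z (r / 2)) \<Omega> c (r / 2)" .
    have "corkscrew (\<Omega> \<inter> ball z (min c (r / 2))) \<Omega> (min c (r / 2)) (min c (r / 2))"
      by (rule corkscrew_mono[OF c(2)]) auto
    then show ?thesis using c(1) r by (intro exI[of _ "min c (r / 2)"]) auto
  qed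
  then obtain r where r: "\<And>z. z \<in> closure \<Omega> \<Longrightarrow> 0 < r z"
    "\<And>z. z \<in> closure \<Omega> \<Longrightarrow> corkscrew (\<Omega> \<inter> ball z (r z)) \<Omega> (r z) (r z)" by metis
  have "compact (closure \<Omega>)" using assms(2) by (simp add: compact_closure)
  moreover have "closure \<Omega> \<subseteq> (\<Union>z\<in>closure \<Omega>. ball z (r z))" using r(1) by force
  ultimately obtain F where F: "F \<subseteq> closure \<Omega>" "finite F" "closure \<Omega> \<subseteq> (\<Union>z\<in>F. ball z (r z))"
    using compactE_image[of "closure \<Omega>" "closure \<Omega>" "\<lambda>z. ball z (r z)"] by auto
  \<comment> \<open>Inserting 1 keeps the set nonempty when \<open>F\<close> is empty.\<close>
  define R where "R = Min (insert 1 (r ` F))"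
  have R: "0 < R" using F r(1) by (auto simp: R_def)
  have R_le: "R \<le> r z" if "z \<in> F" for z using that F(2) by (auto simp: R_def)
  have "corkscrew \<Omega> \<Omega> R R" unfolding corkscrew_def
  proof (intro ballI allI impI)
    fix x \<rho> assume x: "x \<in> \<Omega>" and \<rho>: "0 < \<rho> \<and> \<rho> \<le> R"
    then obtain z where z: "z \<in> F" "x \<in> ball z (r z)" using F(3) closure_subset by blast
    have "corkscrew (\<Omega> \<inter> ball z (r z)) \<Omega> R R"
      using corkscrew_mono[OF r(2)] F(1) z(1) R_le[OF z(1)] by blast
    then show "\<exists>\<zeta>. ball \<zeta> (R * \<rho>) \<subseteq> \<Omega> \<inter> ball x \<rho>" using x z(2) \<rho> by (auto simp: corkscrew_def)
  qed
  then show ?thesis using that R by blast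
qed

section \<open>Kernels and averaging over the third point\<close>

text \<open>
  The weight \<open>r powr (- q)\<close> of the pair \<open>(x, y)\<close> at distance \<open>r\<close>, divided by the volume scale
  \<open>(M * r) powr d\<close> of the ball over which \<open>z\<close> is averaged; \<open>t\<close> is the distance of \<open>z\<close> from \<open>x\<close> or \<open>y\<close>.
\<close>
definition transfer_kernel :: "real \<Rightarrow> real \<Rightarrow> real \<Rightarrow> real \<Rightarrow> real \<Rightarrow> real \<Rightarrow> real \<Rightarrow> ennreal" where
  "transfer_kernel d q c M \<epsilon> r t =
    (if \<epsilon> < r \<and> c * (M * r) / 8 \<le> t \<and> t \<le> 2 * (M * r)
     then ennreal (1 / ((M * r) powr d * r powr q)) else 0)"

definition truncated_kernel :: "real \<Rightarrow> real \<Rightarrow> real \<Rightarrow> ennreal" where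
  "truncated_kernel q \<epsilon> t = (if \<epsilon> < t then ennreal (t powr - q) else 0)"

lemma borel_measurable_transfer_kernel [measurable]:
  assumes [measurable]: "f \<in> borel_measurable N" "g \<in> borel_measurable N"
  shows "(\<lambda>x. transfer_kernel d q c M \<epsilon> (f x) (g x)) \<in> borel_measurable N"
  unfolding transfer_kernel_def by measurable

lemma borel_measurable_truncated_kernel [measurable]:
  assumes [measurable]: "f \<in> borel_measurable N"
  shows "(\<lambda>x. truncated_kernel q \<epsilon> (f x)) \<in> borel_measurable N"
  unfolding truncated_kernel_def by measurable

text \<open>For fixed \<open>t = norm (y - z)\<close>, the admissible \<open>x\<close> lie in a ball
  around \<open>y\<close> of radius \<open>8 * t / (c * M)\<close>, and the kernel is largest at the
  smallest admissible distance \<open>t / (2 * M)\<close>. Volume times maximum gives the power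
  \<open>M powr (q - d)\<close>, which decides the absorption. The cut-off passes from
  \<open>r\<close> to \<open>t\<close> because \<open>8 \<le> c * M\<close> forces
  \<open>r \<le> t\<close>.\<close>

lemma nn_integral_transfer_kernel_le:
  fixes y z :: "'a::euclidean_space" and q c M \<epsilon> :: real
  defines "d \<equiv> real DIM('a)"
  assumes \<Omega>: "\<Omega> \<in> sets lebesgue" and c: "0 < c" and M: "8 / c \<le> M" and q: "0 < q" and \<epsilon>: "0 \<le> \<epsilon>"
  shows "(\<integral>\<^sup>+x. transfer_kernel d q c M \<epsilon> (norm (y - x)) (norm (y - z)) \<partial>lebesgue_on \<Omega>)
    \<le> ennreal (unit_ball_vol d * (16 / c) powr d * 2 powr q * M powr (q - d)) *
        truncated_kernel q \<epsilon> (norm (y - z))"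
proof -
  define t where "t = norm (y - z)"
  have cM: "8 \<le> c * M" using M c by (simp add: field_simps)
  have M0: "0 < M" using M c by (meson divide_pos_pos less_le_trans zero_less_numeral)
  have r_le: "r \<le> 8 * t / (c * M)" "r \<le> t" if "c * (M * r) / 8 \<le> t" "0 < r" for r
  proof -
    show "r \<le> 8 * t / (c * M)" using that c M0 by (simp add: field_simps)
    have "8 * r \<le> c * M * r" using cM that(2) by (intro mult_right_mono) auto
    then show "r \<le> t" using that(1) by simp
  qed
  show ?thesis
  proof (cases "\<epsilon> < t")
    case False
    then have "transfer_kernel d q c M \<epsilon> (norm (y - x)) t = 0" for x
      using r_le(2)[of "norm (y - x)"] \<epsilon> by (auto simp: transfer_kernel_def)
    then show ?thesis by (simp add: t_def)
  next
    case True
    then have t: "0 < t" using \<epsilon> by simp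
    \<comment> \<open>The value of the kernel at \<open>r = t / (2 * M)\<close>, where
      \<open>M * r = t / 2\<close>.\<close>
    define a where "a = 1 / ((t / 2) powr d * (t / (2 * M)) powr q)"
    define \<rho> where "\<rho> = 8 * t / (c * M)"
    have \<rho>: "0 < \<rho>" using t c M0 by (simp add: \<rho>_def)
    have ptw: "transfer_kernel d q c M \<epsilon> (norm (y - x)) t \<le> ennreal a * indicator (cball y \<rho>) x" for x
    proof (cases "\<epsilon> < norm (y - x) \<and> c * (M * norm (y - x)) / 8 \<le> t \<and> t \<le> 2 * (M * norm (y - x))")
      case True
      have r0: "0 < norm (y - x)" using True \<epsilon> by linarith
      have "x \<in> cball y \<rho>" using r_le(1) True r0 by (simp add: \<rho>_def dist_norm)
      moreover have "1 / ((M * norm (y - x)) powr d * norm (y - x) powr q) \<le> a"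
        unfolding a_def
      proof (intro divide_left_mono mult_mono mult_pos_pos)
        show "(t / 2) powr d \<le> (M * norm (y - x)) powr d"
          using True t by (intro powr_mono2) (auto simp: d_def)
        show "(t / (2 * M)) powr q \<le> norm (y - x) powr q"
          using True t M0 q by (intro powr_mono2) (auto simp: field_simps)
      qed (use t M0 r0 in auto)
      ultimately show ?thesis using True by (simp add: transfer_kernel_def ennreal_leI)
    next
      case False
      then show ?thesis by (auto simp: transfer_kernel_def)
    qed
    have "(\<integral>\<^sup>+x. transfer_kernel d q c M \<epsilon> (norm (y - x)) t \<partial>lebesgue_on \<Omega>)
        \<le> (\<integral>\<^sup>+x. ennreal a * indicator (cball y \<rho>) x \<partial>lebesgue)"
      using \<Omega> by (subst nn_integral_restrict_space)
        (auto intro!: nn_integral_mono order_trans[OF _ ptw] split: split_indicator)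
    also have "\<dots> = ennreal a * ennreal (unit_ball_vol d * \<rho> ^ DIM('a))"
      using \<rho> by (subst nn_integral_cmult_indicator) (auto simp: emeasure_cball d_def)
    also have "\<dots> = ennreal (a * (unit_ball_vol d * \<rho> powr d))"
      using powr_realpow[OF \<rho>, of "DIM('a)"] by (simp add: a_def d_def ennreal_mult'[symmetric])
    also have "a * (unit_ball_vol d * \<rho> powr d) =
        unit_ball_vol d * (16 / c) powr d * 2 powr q * M powr (q - d) * t powr - q"
    proof -
      have 1: "(16 / c) powr d = \<rho> powr d * M powr d / (t / 2) powr d"
        using t c M0 \<rho> by (simp add: \<rho>_def powr_mult[symmetric] powr_divide[symmetric])
      have 2: "(t / (2 * M)) powr q = t powr q / (2 powr q * M powr q)"
        using t M0 by (simp add: powr_mult powr_divide)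
      show ?thesis
        unfolding a_def 1 2 powr_diff powr_minus using t M0 by (simp add: field_simps)
    qed
    finally show ?thesis using True t by (simp add: t_def truncated_kernel_def ennreal_mult'')
  qed
qed

text \<open>The pointwise estimate is averaged over the ball of \<open>difference_le_strain\<close>.
  The window in \<open>transfer_kernel\<close> is exactly the range of distances which that lemma
  guarantees, so the ball may be replaced by kernels that no longer mention its centre. The constant
  \<open>24 / c\<close> is \<open>8 / c\<close> times the 3 from
  \<open>powr_sum3_le\<close>.\<close>

lemma nn_integral_strain_ball_le:
  fixes u :: "'a::euclidean_space \<Rightarrow> 'a" and q p c M \<epsilon> :: real
  defines "d \<equiv> real DIM('a)"
  assumes \<Omega>: "\<Omega> \<in> sets lebesgue" and u[measurable]: "u \<in> borel_measurable (lebesgue_on \<Omega>)"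
    and cs: "corkscrew \<Omega> \<Omega> c R" and c: "0 < c" and M: "8 / c \<le> M" "1 \<le> M"
    and p: "0 < p" and \<epsilon>: "0 \<le> \<epsilon>"
    and x: "x \<in> \<Omega>" and xy: "\<epsilon> < norm (x - y)" "M * norm (x - y) \<le> R"
  shows "ennreal (norm (u x - u y) powr p) * truncated_kernel q \<epsilon> (norm (x - y)) \<le>
    ennreal ((24 / c) powr p / (unit_ball_vol d * (c / 4) powr d)) *
    (\<integral>\<^sup>+z. ennreal (M powr - p) * (transfer_kernel d q c M \<epsilon> (norm (x - y)) (norm (y - z)) * ennreal (norm (u y - u z) powr p))
      + (transfer_kernel d q c M \<epsilon> (norm (x - y)) (norm (x - z)) * ennreal (strain u x z powr p)
      + transfer_kernel d q c M \<epsilon> (norm (x - y)) (norm (y - z)) * ennreal (strain u y z powr p)) \<partial>lebesgue_on \<Omega>)"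
   (is "_ \<le> ennreal ?A * (\<integral>\<^sup>+z. ?F z \<partial>_)")
proof -
  define r where "r = norm (x - y)"
  have r: "0 < r" "x \<noteq> y" using xy \<epsilon> by (auto simp: r_def)
  have M0: "0 < M" using M by simp
  have "0 < M * r \<and> M * r \<le> R" using M0 r xy by (simp add: r_def)
  then obtain \<zeta> where "ball \<zeta> (c * (M * r)) \<subseteq> \<Omega> \<inter> ball x (M * r)"
    using cs x unfolding corkscrew_def by blast
  from difference_le_strain[OF c M r(2) this[unfolded r_def], of u]
  obtain \<zeta>' where \<zeta>': "\<And>z. z \<in> ball \<zeta>' (c * (M * r) / 4) \<Longrightarrow> z \<in> \<Omega> \<and>
       c * (M * r) / 8 \<le> norm (x - z) \<and> norm (x - z) \<le> 2 * (M * r) \<and>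
       c * (M * r) / 8 \<le> norm (y - z) \<and> norm (y - z) \<le> 2 * (M * r) \<and>
       norm (u x - u y) \<le> 8 / c * (norm (u y - u z) / M + strain u x z + strain u y z)"
    unfolding r_def by blast
  define B where "B = ball \<zeta>' (c * (M * r) / 4)"
  define I where "I = (\<integral>\<^sup>+z. ?F z \<partial>lebesgue_on \<Omega>)"
  define w where "w = 1 / ((M * r) powr d * r powr q)"
  define V where "V = unit_ball_vol d * (c * (M * r) / 4) ^ DIM('a)"
  have B\<Omega>: "B \<subseteq> \<Omega>" using \<zeta>' by (auto simp: B_def)
  have w0: "0 \<le> w" by (simp add: w_def)
  have [measurable]: "(\<lambda>z::'a. z) \<in> borel_measurable (lebesgue_on \<Omega>)"
    by (intro measurable_restrict_space1 measurable_completion) simp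
  have F_measurable: "?F \<in> borel_measurable (lebesgue_on \<Omega>)" unfolding strain_def by measurable
  have ptw: "ennreal (norm (u x - u y) powr p * w) * indicator B z \<le> ennreal ((24 / c) powr p) * ?F z" for z
  proof (cases "z \<in> B")
    case True
    note z = \<zeta>'[OF True[unfolded B_def]]
    \<comment> \<open>On the ball both kernels equal the constant \<open>w\<close>, since they
      depend on \<open>z\<close> only through the window.\<close>
    have T: "transfer_kernel d q c M \<epsilon> (norm (x - y)) (norm (x - z)) = ennreal w"
        "transfer_kernel d q c M \<epsilon> (norm (x - y)) (norm (y - z)) = ennreal w"
      using z xy(1) by (auto simp: transfer_kernel_def w_def r_def[symmetric])
    have "norm (u x - u y) powr p \<le> (8 / c * (norm (u y - u z) / M + strain u x z + strain u y z)) powr p"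
      using z p by (intro powr_mono2) auto
    also have "\<dots> = (8 / c) powr p * (norm (u y - u z) / M + strain u x z + strain u y z) powr p"
      by (rule powr_mult)
    also have "\<dots> \<le> (8 / c) powr p *
        (3 powr p * ((norm (u y - u z) / M) powr p + strain u x z powr p + strain u y z powr p))"
      using M0 p by (intro mult_left_mono powr_sum3_le) (auto simp: strain_def)
    also have "\<dots> = (24 / c) powr p *
        (M powr - p * norm (u y - u z) powr p + strain u x z powr p + strain u y z powr p)"
    proof -
      have "(24 / c) powr p = (8 / c) powr p * 3 powr p" using c by (simp add: powr_mult[symmetric])
      moreover have "(norm (u y - u z) / M) powr p = M powr - p * norm (u y - u z) powr p"
        using M0 by (simp add: powr_divide powr_minus field_simps)
      ultimately show ?thesis by simp
    qed
    finally have "norm (u x - u y) powr p * w \<le> (24 / c) powr p *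
        (M powr - p * norm (u y - u z) powr p + strain u x z powr p + strain u y z powr p) * w"
      using w0 by (rule mult_right_mono)
    also have "\<dots> = (24 / c) powr p * (M powr - p * (w * norm (u y - u z) powr p) +
        (w * strain u x z powr p + w * strain u y z powr p))" by (simp add: algebra_simps)
    finally have "ennreal (norm (u x - u y) powr p * w) \<le> ennreal \<dots>" by (rule ennreal_leI)
    then show ?thesis unfolding T using True w0 by (simp add: ennreal_mult ennreal_plus)
  qed simp
  have emB: "emeasure (lebesgue_on \<Omega>) B = ennreal V"
    using \<Omega> B\<Omega> c M0 r by (subst emeasure_restrict_space) (auto simp: B_def V_def d_def emeasure_ball)
  have Beq: "V = unit_ball_vol d * (c / 4) powr d * (M * r) powr d"
    using c M0 r by (simp add: V_def d_def powr_realpow power_mult_distrib power_divide field_simps)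
  have ub: "0 < unit_ball_vol d" by (simp add: d_def)
  \<comment> \<open>The volume of \<open>B\<close> divided by \<open>(M * r) powr d\<close>; hence
    \<open>w * V / b\<close> is exactly the weight \<open>r powr - q\<close>.\<close>
  define b where "b = unit_ball_vol d * (c / 4) powr d"
  have b: "0 < b" using ub c by (simp add: b_def)
  have "ennreal (norm (u x - u y) powr p * w) * ennreal V =
      (\<integral>\<^sup>+z. ennreal (norm (u x - u y) powr p * w) * indicator B z \<partial>lebesgue_on \<Omega>)"
    using \<Omega> B\<Omega> emB by (subst nn_integral_cmult_indicator) (auto simp: B_def sets_restrict_space_iff)
  also have "\<dots> \<le> (\<integral>\<^sup>+z. ennreal ((24 / c) powr p) * ?F z \<partial>lebesgue_on \<Omega>)"
    by (intro nn_integral_mono ptw)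
  also have "\<dots> = ennreal ((24 / c) powr p) * I"
    unfolding I_def by (rule nn_integral_cmult[OF F_measurable])
  finally have *: "ennreal (norm (u x - u y) powr p * w * V) \<le> ennreal ((24 / c) powr p) * I"
    using w0 by (simp add: ennreal_mult')
  have wV: "w * V / b = r powr - q" using r M0 b
    by (simp add: w_def Beq b_def[symmetric] powr_minus field_simps)
  have "ennreal (norm (u x - u y) powr p) * truncated_kernel q \<epsilon> (norm (x - y)) =
      ennreal (1 / b) * ennreal (norm (u x - u y) powr p * w * V)"
    using xy b w0 wV[symmetric] by (simp add: truncated_kernel_def ennreal_mult'[symmetric] r_def[symmetric] mult.assoc)
  also have "\<dots> \<le> ennreal (1 / b) * (ennreal ((24 / c) powr p) * I)"
    using * by (intro mult_left_mono) auto
  also have "\<dots> = ennreal ?A * I"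
    using b by (simp add: mult.assoc[symmetric] ennreal_mult'[symmetric] b_def[symmetric])
  finally show ?thesis unfolding I_def .
qed

text \<open>By Tonelli, \<open>y\<close> is integrated before \<open>z\<close>: \<open>g x z\<close>
  is free of \<open>y\<close>, and the integral of the kernel over \<open>y\<close> returns the
  truncated weight of the pair \<open>(x, z)\<close>.\<close>

lemma nn_integral_transfer_le:
  fixes g :: "'a::euclidean_space \<Rightarrow> 'a \<Rightarrow> ennreal" and q c M \<epsilon> :: real
  defines "d \<equiv> real DIM('a)"
  assumes \<Omega>: "\<Omega> \<in> lmeasurable" and c: "0 < c" and M: "8 / c \<le> M" and q: "0 < q" and \<epsilon>: "0 \<le> \<epsilon>"
    and g[measurable]: "case_prod g \<in> borel_measurable (lebesgue_on \<Omega> \<Otimes>\<^sub>M lebesgue_on \<Omega>)"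
  defines "K \<equiv> unit_ball_vol d * (16 / c) powr d * 2 powr q * M powr (q - d)"
  shows "(\<integral>\<^sup>+x. \<integral>\<^sup>+y. \<integral>\<^sup>+z. transfer_kernel d q c M \<epsilon> (norm (x - y)) (norm (x - z)) * g x z
        \<partial>lebesgue_on \<Omega> \<partial>lebesgue_on \<Omega> \<partial>lebesgue_on \<Omega>)
      \<le> ennreal K * (\<integral>\<^sup>+x. \<integral>\<^sup>+z. g x z * truncated_kernel q \<epsilon> (norm (x - z)) \<partial>lebesgue_on \<Omega> \<partial>lebesgue_on \<Omega>)"
    (is "?L \<le> _")
proof -
  define N where "N = lebesgue_on \<Omega>"
  interpret finite_measure N unfolding N_def by (rule finite_measure_lebesgue_on[OF \<Omega>])
  interpret P: pair_sigma_finite N N ..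
  note g' [measurable] = g[folded N_def]
  have id[measurable]: "(\<lambda>z::'a. z) \<in> borel_measurable N"
    unfolding N_def by (intro measurable_restrict_space1 measurable_completion) simp
  have sets\<Omega>: "\<Omega> \<in> sets lebesgue" using \<Omega> by (rule fmeasurableD)
  have gx: "g x \<in> borel_measurable N" if "x \<in> space N" for x
    using measurable_compose[OF measurable_Pair1'[OF that] g'] by simp
  have "?L = (\<integral>\<^sup>+x. \<integral>\<^sup>+y. \<integral>\<^sup>+z. transfer_kernel d q c M \<epsilon> (norm (x - y)) (norm (x - z)) * g x z \<partial>N \<partial>N \<partial>N)"
    by (simp add: N_def)
  also have "\<dots> \<le> (\<integral>\<^sup>+x. ennreal K * (\<integral>\<^sup>+z. g x z * truncated_kernel q \<epsilon> (norm (x - z)) \<partial>N) \<partial>N)"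
  proof (rule nn_integral_mono)
    fix x assume x: "x \<in> space N"
    note gx[OF x, measurable]
    have "(\<integral>\<^sup>+y. \<integral>\<^sup>+z. transfer_kernel d q c M \<epsilon> (norm (x - y)) (norm (x - z)) * g x z \<partial>N \<partial>N)
        = (\<integral>\<^sup>+z. \<integral>\<^sup>+y. transfer_kernel d q c M \<epsilon> (norm (x - y)) (norm (x - z)) * g x z \<partial>N \<partial>N)"
      by (rule P.Fubini') measurable
    also have "\<dots> = (\<integral>\<^sup>+z. (\<integral>\<^sup>+y. transfer_kernel d q c M \<epsilon> (norm (x - y)) (norm (x - z)) \<partial>N) * g x z \<partial>N)"
      by (intro nn_integral_cong nn_integral_multc) measurable
    also have "\<dots> \<le> (\<integral>\<^sup>+z. ennreal K * truncated_kernel q \<epsilon> (norm (x - z)) * g x z \<partial>N)"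
      using nn_integral_transfer_kernel_le[OF sets\<Omega> c M q \<epsilon>]
      by (intro nn_integral_mono mult_right_mono) (auto simp: N_def d_def K_def)
    also have "\<dots> = ennreal K * (\<integral>\<^sup>+z. g x z * truncated_kernel q \<epsilon> (norm (x - z)) \<partial>N)"
      by (subst nn_integral_cmult[symmetric]) (auto simp: mult_ac)
    finally show "(\<integral>\<^sup>+y. \<integral>\<^sup>+z. transfer_kernel d q c M \<epsilon> (norm (x - y)) (norm (x - z)) * g x z \<partial>N \<partial>N)
        \<le> ennreal K * (\<integral>\<^sup>+z. g x z * truncated_kernel q \<epsilon> (norm (x - z)) \<partial>N)" .
  qed
  also have "\<dots> = ennreal K * (\<integral>\<^sup>+x. \<integral>\<^sup>+z. g x z * truncated_kernel q \<epsilon> (norm (x - z)) \<partial>N \<partial>N)"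
    by (rule nn_integral_cmult) measurable
  finally show ?thesis by (simp add: N_def)
qed

section \<open>Distant pairs and tools for the absorption\<close>

text \<open>Beyond distance \<open>\<delta>\<close> the weight is at most
  \<open>\<delta> powr - q\<close>, and the difference splits into its two values. This serves
  twice: with \<open>\<delta> = \<epsilon>\<close> for finiteness of the truncated integral, and
  with \<open>\<delta> = R / M\<close> for pairs too distant for the corkscrew condition.\<close>

lemma nn_integral_far_le:
  fixes u :: "'a::euclidean_space \<Rightarrow> 'b::euclidean_space" and p q \<delta> :: real
  assumes \<Omega>: "\<Omega> \<in> lmeasurable" and u[measurable]: "u \<in> borel_measurable (lebesgue_on \<Omega>)"
    and p: "0 < p" and q: "0 < q" and \<delta>: "0 < \<delta>"
  shows "(\<integral>\<^sup>+x. \<integral>\<^sup>+y. (if \<delta> < norm (x - y) then ennreal (norm (u x - u y) powr p) * ennreal (norm (x - y) powr - q) else 0)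
        \<partial>lebesgue_on \<Omega> \<partial>lebesgue_on \<Omega>)
    \<le> ennreal (2 * 3 powr p * \<delta> powr - q * measure lebesgue \<Omega>) *
        (\<integral>\<^sup>+x. ennreal (norm (u x) powr p) \<partial>lebesgue_on \<Omega>)"
proof -
  define N where "N = lebesgue_on \<Omega>"
  note [measurable] = u[folded N_def]
  interpret finite_measure N unfolding N_def by (rule finite_measure_lebesgue_on[OF \<Omega>])
  interpret P: pair_sigma_finite N N ..
  have sets\<Omega>: "\<Omega> \<in> sets lebesgue" using \<Omega> by (rule fmeasurableD)
  define a where "a = 3 powr p * \<delta> powr - q"
  define L where "L = (\<integral>\<^sup>+x. ennreal (norm (u x) powr p) \<partial>N)"
  have vol: "emeasure N (space N) = ennreal (measure lebesgue \<Omega>)"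
    using \<Omega> sets\<Omega> by (simp add: N_def emeasure_restrict_space space_restrict_space emeasure_eq_measure2)
  have "(if \<delta> < norm (x - y) then ennreal (norm (u x - u y) powr p) * ennreal (norm (x - y) powr - q) else 0)
    \<le> ennreal a * (ennreal (norm (u x) powr p) + ennreal (norm (u y) powr p))" for x y
  proof (cases "\<delta> < norm (x - y)")
    case True
    \<comment> \<open>The summand 0 brings the two-term sum into the form of
      \<open>powr_sum3_le\<close>.\<close>
    have "norm (u x - u y) powr p \<le> (norm (u x) + norm (u y) + 0) powr p"
      using p norm_triangle_ineq4[of "u x" "u y"] by (intro powr_mono2) auto
    also have "\<dots> \<le> 3 powr p * (norm (u x) powr p + norm (u y) powr p + 0 powr p)"
      using p by (intro powr_sum3_le) auto
    finally have "norm (u x - u y) powr p * norm (x - y) powr - q \<le>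
        3 powr p * (norm (u x) powr p + norm (u y) powr p) * \<delta> powr - q"
      using True \<delta> q by (intro mult_mono powr_mono2') auto
    also have "\<dots> = a * (norm (u x) powr p + norm (u y) powr p)" by (simp add: a_def)
    finally have "ennreal (norm (u x - u y) powr p * norm (x - y) powr - q) \<le>
      ennreal (a * (norm (u x) powr p + norm (u y) powr p))" by (rule ennreal_leI)
    then show ?thesis using True by (simp add: ennreal_mult ennreal_plus a_def)
  qed simp
  then have "(\<integral>\<^sup>+x. \<integral>\<^sup>+y. (if \<delta> < norm (x - y) then ennreal (norm (u x - u y) powr p) * ennreal (norm (x - y) powr - q) else 0) \<partial>N \<partial>N)
    \<le> (\<integral>\<^sup>+x. \<integral>\<^sup>+y. ennreal a * (ennreal (norm (u x) powr p) + ennreal (norm (u y) powr p)) \<partial>N \<partial>N)"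
    by (intro nn_integral_mono)
  also have "\<dots> = (\<integral>\<^sup>+x. ennreal a * (ennreal (norm (u x) powr p) * emeasure N (space N) + L) \<partial>N)"
    by (simp add: nn_integral_cmult nn_integral_add L_def)
  also have "\<dots> = ennreal a * (L * emeasure N (space N) + L * emeasure N (space N))"
    by (simp add: nn_integral_cmult nn_integral_add nn_integral_multc L_def[symmetric])
  also have "\<dots> = ennreal (2 * a * measure lebesgue \<Omega>) * L"
  proof -
    have "ennreal (2 * a * measure lebesgue \<Omega>) = ennreal a * (2 * ennreal (measure lebesgue \<Omega>))"
      by (simp add: ennreal_mult a_def ac_simps)
    then show ?thesis unfolding vol by (simp add: mult_2[symmetric] ac_simps)
  qed
  finally show ?thesis by (simp add: N_def L_def a_def mult_ac)
qed

text \<open>Finiteness of \<open>W\<close> permits subtracting \<open>a * W\<close>, which is at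
  most half of \<open>W\<close>.\<close>

lemma ennreal_absorb:
  fixes W Y :: ennreal
  assumes "W \<le> ennreal a * W + Y" "a \<le> 1 / 2" "0 \<le> a" "W < \<infinity>"
  shows "W \<le> 2 * Y"
proof (cases Y)
  case (real y)
  obtain w where w: "W = ennreal w" "0 \<le> w" using assms(4) by (cases W) auto
  have "w \<le> a * w + y"
    using assms(1,3) w real by (simp add: ennreal_mult[symmetric] ennreal_plus[symmetric] del: ennreal_plus)
  moreover have "a * w \<le> 1 / 2 * w" using assms(2) w(2) by (rule mult_right_mono)
  ultimately have "w \<le> 2 * y" by simp
  then have "ennreal w \<le> ennreal (2 * y)" by (rule ennreal_leI)
  then show ?thesis using w real by (simp add: ennreal_mult)
qed (simp add: ennreal_mult_top)

lemma (in sigma_finite_measure) nn_integral_nn_integral_add: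
  assumes f: "case_prod f \<in> borel_measurable (M \<Otimes>\<^sub>M M)" and g: "case_prod g \<in> borel_measurable (M \<Otimes>\<^sub>M M)"
  shows "(\<integral>\<^sup>+x. \<integral>\<^sup>+y. f x y + g x y \<partial>M \<partial>M) = (\<integral>\<^sup>+x. \<integral>\<^sup>+y. f x y \<partial>M \<partial>M) + (\<integral>\<^sup>+x. \<integral>\<^sup>+y. g x y \<partial>M \<partial>M)"
proof -
  have "(\<integral>\<^sup>+x. \<integral>\<^sup>+y. f x y + g x y \<partial>M \<partial>M) = (\<integral>\<^sup>+x. (\<integral>\<^sup>+y. f x y \<partial>M) + (\<integral>\<^sup>+y. g x y \<partial>M) \<partial>M)"
    using measurable_compose[OF measurable_Pair1' f] measurable_compose[OF measurable_Pair1' g]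
    by (intro nn_integral_cong nn_integral_add) auto
  also have "\<dots> = (\<integral>\<^sup>+x. \<integral>\<^sup>+y. f x y \<partial>M \<partial>M) + (\<integral>\<^sup>+x. \<integral>\<^sup>+y. g x y \<partial>M \<partial>M)"
    by (intro nn_integral_add borel_measurable_nn_integral f g)
  finally show ?thesis .
qed

lemma (in sigma_finite_measure) nn_integral_nn_integral_cmult:
  assumes f: "case_prod f \<in> borel_measurable (M \<Otimes>\<^sub>M M)"
  shows "(\<integral>\<^sup>+x. \<integral>\<^sup>+y. c * f x y \<partial>M \<partial>M) = c * (\<integral>\<^sup>+x. \<integral>\<^sup>+y. f x y \<partial>M \<partial>M)"
proof -
  have "(\<integral>\<^sup>+x. \<integral>\<^sup>+y. c * f x y \<partial>M \<partial>M) = (\<integral>\<^sup>+x. c * (\<integral>\<^sup>+y. f x y \<partial>M) \<partial>M)"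
    using measurable_compose[OF measurable_Pair1' f]
    by (intro nn_integral_cong nn_integral_cmult) auto
  also have "\<dots> = c * (\<integral>\<^sup>+x. \<integral>\<^sup>+y. f x y \<partial>M \<partial>M)"
    by (intro nn_integral_cmult borel_measurable_nn_integral f)
  finally show ?thesis .
qed

section \<open>The truncated inequality by absorption\<close>

text \<open>The bound \<open>B\<close> is uniform in \<open>\<epsilon>\<close>, so that the cut-off
  can be removed afterwards. To this end \<open>M\<close> is fixed before \<open>\<epsilon>\<close>
  and \<open>u\<close>, from \<open>c\<close>, \<open>d\<close>, \<open>p\<close> and
  \<open>q\<close> alone.\<close>

lemma truncated_korn:
  fixes \<Omega> :: "'a::euclidean_space set" and q p c R :: real
  defines "d \<equiv> real DIM('a)"
  assumes \<Omega>: "\<Omega> \<in> lmeasurable" and cs: "corkscrew \<Omega> \<Omega> c R" and c: "0 < c" and R: "0 < R"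
    and p: "0 < p" and q: "0 < q" "q - d < p"
  obtains B where "0 < B" "\<And>\<epsilon> u. 0 < \<epsilon> \<Longrightarrow> u \<in> borel_measurable (lebesgue_on \<Omega>) \<Longrightarrow>
    (\<integral>\<^sup>+x. \<integral>\<^sup>+y. ennreal (norm (u x - u y) powr p) * truncated_kernel q \<epsilon> (norm (x - y)) \<partial>lebesgue_on \<Omega> \<partial>lebesgue_on \<Omega>)
    \<le> ennreal B * ((\<integral>\<^sup>+x. \<integral>\<^sup>+y. ennreal (strain u x y powr p) * ennreal (norm (x - y) powr - q) \<partial>lebesgue_on \<Omega> \<partial>lebesgue_on \<Omega>)
       + (\<integral>\<^sup>+x. ennreal (norm (u x) powr p) \<partial>lebesgue_on \<Omega>))"
proof -
  define N where "N = lebesgue_on \<Omega>"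
  interpret finite_measure N unfolding N_def by (rule finite_measure_lebesgue_on[OF \<Omega>])
  interpret P: pair_sigma_finite N N ..
  have id[measurable]: "(\<lambda>z::'a. z) \<in> borel_measurable N"
    unfolding N_def by (intro measurable_restrict_space1 measurable_completion) simp
  have sets\<Omega>: "\<Omega> \<in> sets lebesgue" using \<Omega> by (rule fmeasurableD)
  have spN: "space N = \<Omega>" by (simp add: N_def space_restrict_space)
  define A where "A = (24 / c) powr p / (unit_ball_vol d * (c / 4) powr d)"
  define K0 where "K0 = unit_ball_vol d * (16 / c) powr d * 2 powr q"
  have ub: "0 < unit_ball_vol d" by (simp add: d_def)
  have A0: "0 < A" and K00: "0 < K0" using ub c by (auto simp: A_def K0_def)
  \<comment> \<open>The term to be absorbed carries \<open>M powr - p\<close> from the pointwise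
    estimate and \<open>M powr (q - d)\<close> from the kernel integral; the product is small for
    large \<open>M\<close> because \<open>q - d < p\<close>.\<close>
  have "((\<lambda>M. M powr (q - d - p)) \<longlongrightarrow> 0) at_top"
    using q(2) by (intro tendsto_neg_powr filterlim_ident) auto
  then have "eventually (\<lambda>M. M powr (q - d - p) < 1 / (2 * A * K0)) at_top"
    using A0 K00 by (intro order_tendstoD) auto
  moreover have "eventually (\<lambda>M. 8 / c \<le> M) at_top" "eventually (\<lambda>M::real. 1 \<le> M) at_top"
    by (rule eventually_ge_at_top)+
  ultimately have "eventually (\<lambda>M. M powr (q - d - p) < 1 / (2 * A * K0) \<and> 8 / c \<le> M \<and> 1 \<le> M) at_top"
    by eventually_elim simp
  then obtain M where M: "M powr (q - d - p) < 1 / (2 * A * K0)" "8 / c \<le> M" "1 \<le> M"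
    by (auto simp: eventually_at_top_linorder)
  have M0: "0 < M" using M by simp
  define K where "K = K0 * M powr (q - d)"
  have K: "0 < K" using K00 M0 by (simp add: K_def)
  have half: "A * M powr - p * K \<le> 1 / 2"
  proof -
    have "A * M powr - p * K = A * K0 * M powr (q - d - p)"
      by (simp add: K_def powr_add[symmetric])
    also have "\<dots> \<le> A * K0 * (1 / (2 * A * K0))" using M(1) A0 K00 by (intro mult_left_mono) auto
    also have "\<dots> = 1 / 2" using A0 K00 by simp
    finally show ?thesis .
  qed
  define F where "F = 2 * 3 powr p * (R / M) powr - q * measure lebesgue \<Omega>"
  \<comment> \<open>The outer factors 2 come from \<open>ennreal_absorb\<close>, the inner one from
    the two strain terms; \<open>F\<close> is the constant for pairs beyond
    \<open>R / M\<close>.\<close>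
  define B where "B = 2 * (2 * A * K) + 2 * F"
  have F: "0 \<le> F" by (simp add: F_def)
  have B: "0 < B" "2 * (2 * A * K) \<le> B" "2 * F \<le> B"
    using F mult_pos_pos[OF A0 K] by (auto simp: B_def intro!: add_pos_nonneg)
  have main: "(\<integral>\<^sup>+x. \<integral>\<^sup>+y. ennreal (norm (u x - u y) powr p) * truncated_kernel q \<epsilon> (norm (x - y)) \<partial>N \<partial>N)
    \<le> ennreal B * ((\<integral>\<^sup>+x. \<integral>\<^sup>+y. ennreal (strain u x y powr p) * ennreal (norm (x - y) powr - q) \<partial>N \<partial>N)
       + (\<integral>\<^sup>+x. ennreal (norm (u x) powr p) \<partial>N))"
    if \<epsilon>: "0 < \<epsilon>" and u[measurable]: "u \<in> borel_measurable N" for \<epsilon> u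
  proof -
    define L where "L = (\<integral>\<^sup>+x. ennreal (norm (u x) powr p) \<partial>N)"
    define X where "X = (\<integral>\<^sup>+x. \<integral>\<^sup>+y. ennreal (strain u x y powr p) * ennreal (norm (x - y) powr - q) \<partial>N \<partial>N)"
    define W where "W = (\<integral>\<^sup>+x. \<integral>\<^sup>+y. ennreal (norm (u x - u y) powr p) * truncated_kernel q \<epsilon> (norm (x - y)) \<partial>N \<partial>N)"
    have mE[measurable]: "(\<lambda>(x, y). ennreal (norm (u x - u y) powr p)) \<in> borel_measurable (N \<Otimes>\<^sub>M N)" by measurable
    have mS[measurable]: "(\<lambda>(x, y). ennreal (strain u x y powr p)) \<in> borel_measurable (N \<Otimes>\<^sub>M N)"
      unfolding strain_def by measurable
    have mS'[measurable]: "(\<lambda>w. strain u (f w) (g w)) \<in> borel_measurable Q"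
      if [measurable]: "f \<in> borel_measurable Q" "g \<in> borel_measurable Q"
        "(\<lambda>w. u (f w)) \<in> borel_measurable Q" "(\<lambda>w. u (g w)) \<in> borel_measurable Q" for f g and Q :: "'c measure"
      unfolding strain_def by measurable
    show ?thesis
    proof (cases "L = \<infinity>")
      case True
      then show ?thesis using B by (simp add: L_def[symmetric] ennreal_mult_top)
    next
      case False
      have far: "(\<integral>\<^sup>+x. \<integral>\<^sup>+y. (if \<delta> < norm (x - y) then ennreal (norm (u x - u y) powr p) * ennreal (norm (x - y) powr - q) else 0)
        \<partial>N \<partial>N) \<le> ennreal (2 * 3 powr p * \<delta> powr - q * measure lebesgue \<Omega>) * L" if "0 < \<delta>" for \<delta>
        using nn_integral_far_le[OF \<Omega> u[unfolded N_def] p q(1) that] by (simp add: N_def L_def)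
      \<comment> \<open>This bound depends on \<open>\<epsilon>\<close> and serves only to make
        \<open>W\<close> finite.\<close>
      have "W \<le> ennreal (2 * 3 powr p * \<epsilon> powr - q * measure lebesgue \<Omega>) * L"
        using far[OF \<epsilon>] unfolding W_def truncated_kernel_def by (simp add: if_distrib cong: if_cong)
      also have "\<dots> < \<infinity>" using False by (simp add: ennreal_mult_less_top less_top)
      finally have W_fin: "W < \<infinity>" .
      define T where "T x y z = transfer_kernel d q c M \<epsilon> (norm (x - y)) (norm (x - z))" for x y z :: 'a
      define J where "J g = (\<integral>\<^sup>+x. \<integral>\<^sup>+y. \<integral>\<^sup>+z. T x y z * g x z \<partial>N \<partial>N \<partial>N)" for g :: "'a \<Rightarrow> 'a \<Rightarrow> ennreal"
      have mT[measurable]: "(\<lambda>x. T (f x) (g x) (h x)) \<in> borel_measurable Q"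
        if [measurable]: "f \<in> borel_measurable Q" "g \<in> borel_measurable Q" "h \<in> borel_measurable Q" for f g h and Q :: "'c measure"
        unfolding T_def by measurable
      have J_le: "J g \<le> ennreal K * (\<integral>\<^sup>+x. \<integral>\<^sup>+z. g x z * truncated_kernel q \<epsilon> (norm (x - z)) \<partial>N \<partial>N)"
        if "case_prod g \<in> borel_measurable (N \<Otimes>\<^sub>M N)" for g
        using nn_integral_transfer_le[OF \<Omega> c M(2) q(1) less_imp_le[OF \<epsilon>] that[unfolded N_def]]
        by (simp add: J_def T_def K_def K0_def N_def d_def)
      let ?E = "\<lambda>x y. ennreal (norm (u x - u y) powr p)"
      let ?S = "\<lambda>x y. ennreal (strain u x y powr p)"
      have JE: "J ?E \<le> ennreal K * W" using J_le[OF mE] by (simp add: W_def)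
      have "J ?S \<le> ennreal K * (\<integral>\<^sup>+x. \<integral>\<^sup>+z. ?S x z * truncated_kernel q \<epsilon> (norm (x - z)) \<partial>N \<partial>N)"
        by (rule J_le[OF mS])
      also have "\<dots> \<le> ennreal K * X" unfolding X_def
        by (intro mult_left_mono nn_integral_mono) (auto simp: truncated_kernel_def)
      finally have JS: "J ?S \<le> ennreal K * X" .
      \<comment> \<open>Interchanging \<open>x\<close> and \<open>y\<close> by Tonelli reduces the
        terms in the pair \<open>(y, z)\<close> to those in \<open>(x, z)\<close>.\<close>
      have J_swap: "(\<integral>\<^sup>+x. \<integral>\<^sup>+y. \<integral>\<^sup>+z. T y x z * g y z \<partial>N \<partial>N \<partial>N) = J g"
        if [measurable]: "case_prod g \<in> borel_measurable (N \<Otimes>\<^sub>M N)" for g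
        unfolding J_def by (rule P.Fubini'[symmetric]) measurable
      let ?H = "\<lambda>x y z. ennreal (M powr - p) * (T y x z * ?E y z) + (T x y z * ?S x z + T y x z * ?S y z)"
      \<comment> \<open>Pairs within \<open>\<epsilon>\<close> have weight 0 and pairs beyond
        \<open>R / M\<close> go into the last term; for all others the scale
        \<open>M * norm (x - y)\<close> is at most \<open>R\<close>, and the averaged estimate
        applies.\<close>
      have ptw: "?E x y * truncated_kernel q \<epsilon> (norm (x - y)) \<le>
         ennreal A * (\<integral>\<^sup>+z. ?H x y z \<partial>N) +
         (if R / M < norm (x - y) then ?E x y * ennreal (norm (x - y) powr - q) else 0)"
        if x: "x \<in> \<Omega>" for x y
      proof -
        have "R / M < norm (x - y) \<or> M * norm (x - y) \<le> R"
          using M0 by (auto simp: not_le field_simps)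
        then consider "norm (x - y) \<le> \<epsilon>" | "R / M < norm (x - y)" | "\<epsilon> < norm (x - y)" "M * norm (x - y) \<le> R"
          by linarith
        then show ?thesis
        proof cases
          case 1
          then show ?thesis by (simp add: truncated_kernel_def)
        next
          case 2
          then have "?E x y * truncated_kernel q \<epsilon> (norm (x - y)) \<le> ?E x y * ennreal (norm (x - y) powr - q)"
            by (intro mult_left_mono) (auto simp: truncated_kernel_def)
          then show ?thesis using 2 by (simp only: if_True add_increasing zero_le)
        next
          case 3
          from nn_integral_strain_ball_le[OF sets\<Omega> u[unfolded N_def] cs c M(2,3) p less_imp_le[OF \<epsilon>] x this, of q]
          have "?E x y * truncated_kernel q \<epsilon> (norm (x - y)) \<le> ennreal A * (\<integral>\<^sup>+z. ?H x y z \<partial>N)"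
            by (simp only: N_def A_def d_def T_def norm_minus_commute[of y x])
          then show ?thesis by (rule order_trans) simp
        qed
      qed
      define I1 where "I1 x y = (\<integral>\<^sup>+z. T y x z * ?E y z \<partial>N)" for x y
      define I2 where "I2 x y = (\<integral>\<^sup>+z. T x y z * ?S x z \<partial>N)" for x y
      define I3 where "I3 x y = (\<integral>\<^sup>+z. T y x z * ?S y z \<partial>N)" for x y
      define G where "G x y = (if R / M < norm (x - y) then ?E x y * ennreal (norm (x - y) powr - q) else 0)" for x y
      have mI[measurable]: "case_prod I1 \<in> borel_measurable (N \<Otimes>\<^sub>M N)" "case_prod I2 \<in> borel_measurable (N \<Otimes>\<^sub>M N)"
          "case_prod I3 \<in> borel_measurable (N \<Otimes>\<^sub>M N)" "case_prod G \<in> borel_measurable (N \<Otimes>\<^sub>M N)"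
        unfolding I1_def I2_def I3_def G_def by measurable
      have H: "(\<integral>\<^sup>+z. ?H x y z \<partial>N) = ennreal (M powr - p) * I1 x y + (I2 x y + I3 x y)" for x y
        unfolding I1_def I2_def I3_def by (simp add: nn_integral_add nn_integral_cmult)
      have "W \<le> (\<integral>\<^sup>+x. \<integral>\<^sup>+y. ennreal A * (ennreal (M powr - p) * I1 x y + (I2 x y + I3 x y)) + G x y \<partial>N \<partial>N)"
        unfolding W_def G_def H[symmetric] by (intro nn_integral_mono ptw) (simp add: spN)
      also have "\<dots> = (\<integral>\<^sup>+x. \<integral>\<^sup>+y. ennreal A * (ennreal (M powr - p) * I1 x y + (I2 x y + I3 x y)) \<partial>N \<partial>N)
          + (\<integral>\<^sup>+x. \<integral>\<^sup>+y. G x y \<partial>N \<partial>N)"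
        by (rule nn_integral_nn_integral_add) measurable
      also have "(\<integral>\<^sup>+x. \<integral>\<^sup>+y. ennreal A * (ennreal (M powr - p) * I1 x y + (I2 x y + I3 x y)) \<partial>N \<partial>N) =
          ennreal A * (\<integral>\<^sup>+x. \<integral>\<^sup>+y. ennreal (M powr - p) * I1 x y + (I2 x y + I3 x y) \<partial>N \<partial>N)"
        by (rule nn_integral_nn_integral_cmult) measurable
      also have "(\<integral>\<^sup>+x. \<integral>\<^sup>+y. ennreal (M powr - p) * I1 x y + (I2 x y + I3 x y) \<partial>N \<partial>N) =
          (\<integral>\<^sup>+x. \<integral>\<^sup>+y. ennreal (M powr - p) * I1 x y \<partial>N \<partial>N) + (\<integral>\<^sup>+x. \<integral>\<^sup>+y. I2 x y + I3 x y \<partial>N \<partial>N)"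
        by (rule nn_integral_nn_integral_add) measurable
      also have "\<dots> = ennreal (M powr - p) * J ?E + (J ?S + J ?S)"
        unfolding nn_integral_nn_integral_cmult[OF mI(1)] nn_integral_nn_integral_add[OF mI(2,3)]
        unfolding I1_def I2_def I3_def J_swap[OF mE] J_swap[OF mS] by (simp only: J_def)
      finally have "W \<le> ennreal A * (ennreal (M powr - p) * J ?E + (J ?S + J ?S)) + (\<integral>\<^sup>+x. \<integral>\<^sup>+y. G x y \<partial>N \<partial>N)" .
      also have "\<dots> \<le> ennreal A * (ennreal (M powr - p) * (ennreal K * W) + (ennreal K * X + ennreal K * X)) + ennreal F * L"
        unfolding F_def G_def using R M0 by (intro add_mono mult_left_mono JE JS far) auto
      also have "\<dots> = ennreal (A * M powr - p * K) * W + (ennreal (2 * A * K) * X + ennreal F * L)"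
        using A0 K by (simp add: ennreal_mult distrib_left mult_2[symmetric] ac_simps)
      finally have "W \<le> 2 * (ennreal (2 * A * K) * X + ennreal F * L)"
        using half A0 K W_fin by (intro ennreal_absorb) auto
      also have "\<dots> = ennreal (2 * (2 * A * K)) * X + ennreal (2 * F) * L"
        using A0 K F by (simp add: ennreal_mult distrib_left ac_simps)
      also have "\<dots> \<le> ennreal B * X + ennreal B * L"
        using B by (intro add_mono mult_right_mono ennreal_leI) auto
      finally show ?thesis by (simp add: W_def X_def L_def distrib_left)
    qed
  qed
  show ?thesis by (rule that[OF B(1) main[unfolded N_def]])
qed

section \<open>Removal of the cut-off and the final inequality\<close>

text \<open>Monotone convergence along the cut-offs \<open>1 / real (Suc n)\<close>: each pair off
  the diagonal is eventually reached, and on the diagonal the integrand vanishes. Passing to the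
  product measure makes one application suffice for the double integral.\<close>

lemma nn_integral_le_if_truncated_le:
  fixes h :: "'a::euclidean_space \<Rightarrow> 'a \<Rightarrow> ennreal"
  assumes \<Omega>: "\<Omega> \<in> lmeasurable"
    and h: "case_prod h \<in> borel_measurable (lebesgue_on \<Omega> \<Otimes>\<^sub>M lebesgue_on \<Omega>)" "\<And>x. h x x = 0"
    and le: "\<And>\<epsilon>. 0 < \<epsilon> \<Longrightarrow>
      (\<integral>\<^sup>+x. \<integral>\<^sup>+y. h x y * truncated_kernel q \<epsilon> (norm (x - y)) \<partial>lebesgue_on \<Omega> \<partial>lebesgue_on \<Omega>) \<le> C"
  shows "(\<integral>\<^sup>+x. \<integral>\<^sup>+y. h x y * ennreal (norm (x - y) powr - q) \<partial>lebesgue_on \<Omega> \<partial>lebesgue_on \<Omega>) \<le> C"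
proof -
  define N where "N = lebesgue_on \<Omega>"
  interpret finite_measure N unfolding N_def by (rule finite_measure_lebesgue_on[OF \<Omega>])
  have id[measurable]: "(\<lambda>z::'a. z) \<in> borel_measurable N"
    unfolding N_def by (intro measurable_restrict_space1 measurable_completion) simp
  note hm[measurable] = h(1)[folded N_def]
  define f where "f n = (\<lambda>(x, y). h x y * truncated_kernel q (1 / real (Suc n)) (norm (x - y)))" for n
  have fm[measurable]: "f n \<in> borel_measurable (N \<Otimes>\<^sub>M N)" for n unfolding f_def by measurable
  have "incseq f"
  proof (rule incseq_SucI, rule le_funI)
    fix n and xy :: "'a \<times> 'a"
    have "1 / real (Suc (Suc n)) \<le> 1 / real (Suc n)" by (intro divide_left_mono) auto
    then show "f n xy \<le> f (Suc n) xy"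
      by (cases xy) (auto simp: f_def truncated_kernel_def intro!: mult_left_mono)
  qed
  have f_SUP: "h x y * ennreal (norm (x - y) powr - q) \<le> (SUP n. f n (x, y))" for x y
  proof (cases "x = y")
    case False
    then obtain n where "1 / real (Suc n) < norm (x - y)"
      using nat_approx_posE[of "norm (x - y)"] by auto
    then have "h x y * ennreal (norm (x - y) powr - q) = f n (x, y)"
      by (simp add: f_def truncated_kernel_def)
    then show ?thesis by (auto intro: SUP_upper)
  qed (simp add: h(2))
  have "(\<integral>\<^sup>+x. \<integral>\<^sup>+y. h x y * ennreal (norm (x - y) powr - q) \<partial>N \<partial>N) \<le> (\<integral>\<^sup>+x. \<integral>\<^sup>+y. (SUP n. f n (x, y)) \<partial>N \<partial>N)"
    by (intro nn_integral_mono f_SUP)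
  also have "\<dots> = (\<integral>\<^sup>+xy. (SUP n. f n xy) \<partial>(N \<Otimes>\<^sub>M N))"
    by (rule nn_integral_fst) measurable
  also have "\<dots> = (SUP n. integral\<^sup>N (N \<Otimes>\<^sub>M N) (f n))"
    by (rule nn_integral_monotone_convergence_SUP[OF \<open>incseq f\<close> fm])
  also have "\<dots> \<le> C"
  proof (rule SUP_least)
    fix n
    have "integral\<^sup>N (N \<Otimes>\<^sub>M N) (f n) = (\<integral>\<^sup>+x. \<integral>\<^sup>+y. f n (x, y) \<partial>N \<partial>N)"
      by (rule nn_integral_fst[symmetric]) measurable
    also have "\<dots> \<le> C" using le[of "1 / real (Suc n)"] by (simp add: f_def N_def)
    finally show "integral\<^sup>N (N \<Otimes>\<^sub>M N) (f n) \<le> C" .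
  qed
  finally show ?thesis by (simp add: N_def)
qed

text \<open>The sum of two finite numbers is at most twice their maximum, and the root of the
  maximum is one of the two roots. If \<open>a\<close> or \<open>b\<close> is infinite, so is the
  right-hand side, its factor being positive.\<close>

lemma ennreal_root_le:
  assumes p: "0 < p" and B: "0 < B" and t: "t \<le> ennreal B * (a + b)"
  shows "ennreal_root p t \<le> ennreal ((2 * B) powr (1 / p)) * (ennreal_root p a + ennreal_root p b)"
proof (cases "a = \<infinity> \<or> b = \<infinity>")
  case True
  then show ?thesis using B by (auto simp: ennreal_root_def ennreal_mult_top)
next
  case False
  then obtain a' b' where a: "a = ennreal a'" "0 \<le> a'" and b: "b = ennreal b'" "0 \<le> b'"
    by (cases a; cases b) auto
  have "t \<le> ennreal (B * (a' + b'))" using t a b B by (simp add: ennreal_mult ennreal_plus)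
  moreover from this obtain t' where t': "t = ennreal t'" "0 \<le> t'" by (cases t) (auto simp: top_unique)
  ultimately have "t' \<le> B * (a' + b')" using a b B by (simp add: ennreal_le_iff)
  also have "\<dots> \<le> 2 * B * max a' b'"
    using B mult_left_mono[of "a' + b'" "2 * max a' b'" B] by (simp add: mult_ac)
  finally have "t' powr (1 / p) \<le> (2 * B * max a' b') powr (1 / p)"
    using t' p by (intro powr_mono2) auto
  also have "\<dots> = (2 * B) powr (1 / p) * max a' b' powr (1 / p)" by (rule powr_mult)
  also have "\<dots> \<le> (2 * B) powr (1 / p) * (a' powr (1 / p) + b' powr (1 / p))"
    by (intro mult_left_mono) (auto simp: max_def)
  finally have "ennreal (t' powr (1 / p)) \<le> ennreal \<dots>" by (rule ennreal_leI)
  then show ?thesis using a b t' by (simp add: ennreal_root_def ennreal_mult ennreal_plus)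
qed

text \<open>With \<open>q = DIM('a) + s * p\<close>, the condition \<open>q - DIM('a) < p\<close> of
  the truncated inequality amounts to \<open>s < 1\<close>. The cut-off is removed first and roots
  are taken last.\<close>

lemma fractional_korn:
  fixes \<Omega> :: "'a::euclidean_space set"
  assumes \<Omega>: "\<Omega> \<in> lmeasurable" and cs: "corkscrew \<Omega> \<Omega> c R" "0 < c" "0 < R"
    and s: "0 < s" "s < 1" and p: "0 < p"
  obtains C where "0 < C" "\<And>u. u \<in> borel_measurable (lebesgue_on \<Omega>) \<Longrightarrow>
    W_seminorm s p \<Omega> u \<le> ennreal C * (X_seminorm s p \<Omega> u + Lp_norm p \<Omega> u)"
proof -
  define q where "q = real DIM('a) + s * p"
  have sp: "0 < s * p" "s * p < p" using s p by auto
  have q: "0 < q" "q - real DIM('a) < p" using sp by (auto simp: q_def add_nonneg_pos)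
  obtain B where B: "0 < B" "\<And>\<epsilon> u. 0 < \<epsilon> \<Longrightarrow> u \<in> borel_measurable (lebesgue_on \<Omega>) \<Longrightarrow>
    (\<integral>\<^sup>+x. \<integral>\<^sup>+y. ennreal (norm (u x - u y) powr p) * truncated_kernel q \<epsilon> (norm (x - y)) \<partial>lebesgue_on \<Omega> \<partial>lebesgue_on \<Omega>)
    \<le> ennreal B * ((\<integral>\<^sup>+x. \<integral>\<^sup>+y. ennreal (strain u x y powr p) * ennreal (norm (x - y) powr - q) \<partial>lebesgue_on \<Omega> \<partial>lebesgue_on \<Omega>)
       + (\<integral>\<^sup>+x. ennreal (norm (u x) powr p) \<partial>lebesgue_on \<Omega>))"
    using truncated_korn[OF \<Omega> cs p q] by blast
  \<comment> \<open>This turns the products with a negative power into the quotients of the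
    seminorms, also at \<open>t = 0\<close>, where both sides are 0.\<close>
  have divide: "ennreal a * ennreal (t powr - q) = ennreal (a / t powr q)" if "0 \<le> a" for a t
    using that by (simp add: powr_minus_divide ennreal_mult[symmetric])
  have "W_seminorm s p \<Omega> u \<le> ennreal ((2 * B) powr (1 / p)) * (X_seminorm s p \<Omega> u + Lp_norm p \<Omega> u)"
    if u[measurable]: "u \<in> borel_measurable (lebesgue_on \<Omega>)" for u
  proof -
    have "(\<integral>\<^sup>+x. \<integral>\<^sup>+y. ennreal (norm (u x - u y) powr p) * ennreal (norm (x - y) powr - q) \<partial>lebesgue_on \<Omega> \<partial>lebesgue_on \<Omega>)
      \<le> ennreal B * ((\<integral>\<^sup>+x. \<integral>\<^sup>+y. ennreal (strain u x y powr p) * ennreal (norm (x - y) powr - q) \<partial>lebesgue_on \<Omega> \<partial>lebesgue_on \<Omega>)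
       + (\<integral>\<^sup>+x. ennreal (norm (u x) powr p) \<partial>lebesgue_on \<Omega>))"
      using B(2)[OF _ u] by (intro nn_integral_le_if_truncated_le[OF \<Omega>]) auto
    from ennreal_root_le[OF p B(1) this] show ?thesis
      by (simp only: W_seminorm_def X_seminorm_def Lp_norm_def strain_def q_def[symmetric] divide powr_ge_zero)
  qed
  then show ?thesis using that[of "(2 * B) powr (1 / p)"] B(1) by auto
qed

lemma continuously_differentiable_borel_measurable:
  fixes u :: "'a::euclidean_space \<Rightarrow> 'b::euclidean_space"
  assumes "\<Omega> \<in> sets lebesgue" "continuously_differentiable_on \<Omega> u"
  shows "u \<in> borel_measurable (lebesgue_on \<Omega>)"
proof -
  have "continuous_on \<Omega> u"
    using assms(2) unfolding continuously_differentiable_on_def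
    by (meson continuous_at_imp_continuous_on has_derivative_continuous)
  then show ?thesis using assms(1) by (rule continuous_imp_measurable_on_sets_lebesgue)
qed

theorem theorem1p1:
  fixes \<Omega> :: "(real ^ 'n) set" and s p :: real
  assumes "CARD('n) \<ge> 2"
    and "0 < s" and "s < 1"
    and "1 < p"
    and "s * p \<noteq> 1"
    and "open \<Omega>" and "connected \<Omega>" and "\<Omega> \<noteq> {}"
    and "bounded \<Omega>"
    and "C1_boundary \<Omega>"
  shows "\<exists>C::real. C > 0 \<and>
    (\<forall>u\<in>C1c \<Omega>. W_seminorm s p \<Omega> u \<le> ennreal C * (X_seminorm s p \<Omega> u + Lp_norm p \<Omega> u)) \<and>
    (\<forall>u\<in>W0 s p \<Omega>. W_seminorm s p \<Omega> u \<le> ennreal C * (X_seminorm s p \<Omega> u + Lp_norm p \<Omega> u))"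
proof -
  have \<Omega>: "\<Omega> \<in> lmeasurable" using assms(6,9) by (rule lmeasurable_open[rotated])
  have p: "0 < p" using assms(4) by simp
  obtain c R where "0 < c" "0 < R" "corkscrew \<Omega> \<Omega> c R"
    using C1_boundary_corkscrew assms(6,9,10) by blast
  then obtain C where C: "0 < C" "\<And>u. u \<in> borel_measurable (lebesgue_on \<Omega>) \<Longrightarrow>
    W_seminorm s p \<Omega> u \<le> ennreal C * (X_seminorm s p \<Omega> u + Lp_norm p \<Omega> u)"
    using fractional_korn[OF \<Omega> _ _ _ assms(2,3) p] by blast
  \<comment> \<open>The estimate holds for all measurable fields, so both classes are covered
    directly and no passage to the limit from \<open>C1c\<close> to \<open>W0\<close> takes
    place.\<close>
  moreover have "u \<in> borel_measurable (lebesgue_on \<Omega>)" if "u \<in> C1c \<Omega>" for u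
    using that continuously_differentiable_borel_measurable[OF fmeasurableD[OF \<Omega>]] by (auto simp: C1c_def)
  moreover have "u \<in> borel_measurable (lebesgue_on \<Omega>)" if "u \<in> W0 s p \<Omega>" for u
    using that by (simp add: W0_def)
  ultimately show ?thesis by blast
qed

end
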